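(* Let $n=n_1+n_2+n_3$ and let $\boldsymbol x=[\boldsymbol q_h^\top\ \boldsymbol p_h^\top\ \boldsymbol x_{co}^\top\ \boldsymbol x_{\bar c\bar o}^\top]^\top$ satisfy $[\boldsymbol x,\boldsymbol x^\top]=\imath\bar{\mathbb J}_n$. Let $\boldsymbol H=\frac12\boldsymbol x^\top H\boldsymbol x$, $\boldsymbol L=\Gamma\boldsymbol x$, where the real symmetric matrix $H$ and the complex matrix $\Gamma\in\mathbb C^{m\times2n}$ have the form $$H=\begin{bmatrix} 0 & H_h^{12} & 0 & 0 \\ H_h^{12\top} & H_h^{22} & H_{12} & H_{13} \\ 0 & H_{12}^\top & H_{co} & 0 \\ 0 & H_{13}^\top & 0 & H_{\bar c\bar o} \end{bmatrix},\qquad \begin{bmatrix} \Gamma \\ \Gamma^{\#} \end{bmatrix}=\begin{bmatrix} 0 & \Gamma_h & \Gamma_{co} & 0 \end{bmatrix}.$$ Then the QSDEs generated by $\boldsymbol H$ and $\boldsymbol L$ are of the form $\dot{\boldsymbol x}=\bar A\boldsymbol x+\bar B\boldsymbol u$, $\boldsymbol y=\bar C\boldsymbol x+\boldsymbol u$ with $$\bar A=\begin{bmatrix} A_h^{11} & A_h^{12} & A_{12} & A_{13} \\ 0 & A_h^{22} & 0 & 0 \\ 0 & A_{21} & A_{co} & 0 \\ 0 & A_{31} & 0 & A_{\bar c\bar o} \end{bmatrix},\quad \bar B=\begin{bmatrix} B_h \\ 0 \\ B_{co} \\ 0 \end{bmatrix},\quad \bar C=\begin{bmatrix} 0 & C_h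 & C_{co} & 0 \end{bmatrix},$$ where $$\begin{aligned} A_h^{11}&=H_h^{12\top},\quad A_h^{12}=H_h^{22}-\tfrac{\imath}{2}\Gamma_h^\dag J_m\Gamma_h,\quad A_h^{22}=-H_h^{12},\\ A_{12}&=H_{12}-\tfrac{\imath}{2}\Gamma_h^\dag J_m\Gamma_{co},\quad A_{13}=H_{13},\\ A_{co}&=\mathbb J_{n_1}H_{co}-\tfrac{\imath}{2}\mathbb J_{n_1}\Gamma_{co}^\dag J_m\Gamma_{co},\quad A_{\bar c\bar o}=\mathbb J_{n_2}H_{\bar c\bar o},\\ A_{21}&=\mathbb J_{n_1}H_{12}^\top-\tfrac{\imath}{2}\mathbb J_{n_1}\Gamma_{co}^\dag J_m\Gamma_h,\quad A_{31}=\mathbb J_{n_2}H_{13}^\top,\\ B_h&=\Gamma_h^\dag V_m^\dag\mathbb J_m,\quad B_{co}=\mathbb J_{n_1}\Gamma_{co}^\dag V_m^\dag\mathbb J_m,\\ C_h&=V_m\Gamma_h,\quad C_{co}=V_m\Gamma_{co}. \end{aligned}$$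
   Context: Notation: $X^{\#}$ is the entrywise adjoint (complex conjugate for numbers), $X^\dag=(X^{\#})^\top$; $\breve X=\begin{bmatrix} X \\ X^{\#} \end{bmatrix}$; $J_k=\mathrm{diag}(I_k,-I_k)$; $\mathbb J_k=\begin{bmatrix} 0 & I_k \\ -I_k & 0 \end{bmatrix}$; $\bar{\mathbb J}_n=\mathrm{diag}(\mathbb J_{n_3},\mathbb J_{n_1},\mathbb J_{n_2})$; $V_k=\frac1{\sqrt2}\begin{bmatrix} I_k & I_k \\ -\imath I_k & \imath I_k \end{bmatrix}$. The entries of $\boldsymbol x$ are self-adjoint operators; the blocks $\boldsymbol q_h,\boldsymbol p_h,\boldsymbol x_{co},\boldsymbol x_{\bar c\bar o}$ have lengths $n_3,n_3,2n_1,2n_2$; matrices are partitioned accordingly. For vectors of operators, $[X,Y^\top]=XY^\top-(YX^\top)^\top$ (the matrix of commutators $[X_i,Y_j]$). QSDEs generated by $\boldsymbol H$ and $\boldsymbol L$: with input fields $\boldsymbol b=[\boldsymbol b_1\cdots\boldsymbol b_m]^\top$ (commuting with system operators in the products below), each system operator $\boldsymbol X$ evolves (formally) as $$\dot{\boldsymbol X}=-\imath[\boldsymbol X,\boldsymbol H]-\tfrac12\breve{\boldsymbol L}^\dag J_m[\breve{\boldsymbol L},\boldsymbol X]-\breve{\boldsymbol b}^\dag J_m[\breve{\boldsymbol L},\boldsymbol X],$$ the outputs are $\breve{\boldsymbol b}_{\mathrm{out}}=\breve{\boldsymbol L}+\breve{\boldsymbol b}$, and the input and output quadratures are the vectors of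 self-adjoint operators $\boldsymbol u=V_m\breve{\boldsymbol b}$, $\boldsymbol y=V_m\breve{\boldsymbol b}_{\mathrm{out}}$. The commutation relations of $\boldsymbol x$ hold at all times. The QSDEs of the claim are obtained for $\boldsymbol X$ ranging over the entries of $\boldsymbol x$. *)

theory Defs
  imports Complex_Main "Jordan_Normal_Form.Matrix"
begin

text \<open>
  The operators (system operators as well as the formal input fields) are unbounded, so they are
  modelled as elements of an abstract unital complex \<open>*\<close>-algebra; \<open>adj\<close> is the adjoint. No norm or
  topology is assumed, since none is compatible with the canonical commutation relations.
\<close>

class complex_star_algebra = ring_1 +
  fixes scaleC :: "complex \<Rightarrow> 'a \<Rightarrow> 'a"
    and adj :: "'a \<Rightarrow> 'a"
  assumes scaleC_add_right: "scaleC c (a + b) = scaleC c a + scaleC c b"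
    and scaleC_add_left: "scaleC (c + d) a = scaleC c a + scaleC d a"
    and scaleC_scaleC: "scaleC c (scaleC d a) = scaleC (c * d) a"
    and scaleC_one: "scaleC 1 a = a"
    and mult_scaleC_left: "scaleC c a * b = scaleC c (a * b)"
    and mult_scaleC_right: "a * scaleC c b = scaleC c (a * b)"
    and adj_adj: "adj (adj a) = a"
    and adj_add: "adj (a + b) = adj a + adj b"
    and adj_mult: "adj (a * b) = adj b * adj a"
    and adj_scaleC: "adj (scaleC c a) = scaleC (cnj c) (adj a)"

text \<open>For numbers the adjoint is the complex conjugate.\<close>

instantiation complex :: complex_star_algebra
begin

definition scaleC_complex :: "complex \<Rightarrow> complex \<Rightarrow> complex"
  where "scaleC_complex c a = c * a"

definition adj_complex :: "complex \<Rightarrow> complex"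
  where "adj_complex a = cnj a"

instance
  by standard (simp_all add: scaleC_complex_def adj_complex_def algebra_simps)

end

definition of_cplx :: "complex \<Rightarrow> 'a::complex_star_algebra"
  where "of_cplx c = scaleC c 1"

text \<open>Action of a matrix of numbers on a column vector of operators.\<close>

definition cmat_mult_vec :: "complex mat \<Rightarrow> 'a::complex_star_algebra vec \<Rightarrow> 'a vec"
    (infixr \<open>*\<^sub>o\<close> 70)
  where "M *\<^sub>o X = map_mat of_cplx M *\<^sub>v X"

definition commutator :: "'a::complex_star_algebra \<Rightarrow> 'a \<Rightarrow> 'a"
  where "commutator a b = a * b - b * a"

text \<open>\<open>commutator_mat X Y\<close> is $[X, Y^\top]$; \<open>commutator_vec X Y\<close> is the column $[X, Y]$ for a
  vector \<open>X\<close> and a single operator \<open>Y\<close>.\<close>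

definition commutator_mat :: "'a::complex_star_algebra vec \<Rightarrow> 'a vec \<Rightarrow> 'a mat"
  where "commutator_mat X Y = mat (dim_vec X) (dim_vec Y) (\<lambda>(i, j). commutator (X $ i) (Y $ j))"

definition commutator_vec :: "'a::complex_star_algebra vec \<Rightarrow> 'a \<Rightarrow> 'a vec"
  where "commutator_vec X Y = vec (dim_vec X) (\<lambda>i. commutator (X $ i) Y)"

definition breve_vec :: "'a::complex_star_algebra vec \<Rightarrow> 'a vec"
  where "breve_vec X = X @\<^sub>v map_vec adj X"

definition breve_mat :: "'a::complex_star_algebra mat \<Rightarrow> 'a mat"
  where "breve_mat X = X @\<^sub>r map_mat adj X"

definition dagger :: "'a::complex_star_algebra mat \<Rightarrow> 'a mat"
  where "dagger X = (map_mat adj X)\<^sup>T"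

definition append_cols :: "'a::zero mat \<Rightarrow> 'a mat \<Rightarrow> 'a mat" (infixr \<open>@\<^sub>c\<close> 66)
  where "A @\<^sub>c B = four_block_mat A B (0\<^sub>m 0 (dim_col A)) (0\<^sub>m 0 (dim_col B))"

definition J_sig :: "nat \<Rightarrow> complex mat"
  where "J_sig k = diag_block_mat [1\<^sub>m k, - 1\<^sub>m k]"

definition J_symp :: "nat \<Rightarrow> complex mat"
  where "J_symp k = four_block_mat (0\<^sub>m k k) (1\<^sub>m k) (- 1\<^sub>m k) (0\<^sub>m k k)"

definition V_quad :: "nat \<Rightarrow> complex mat"
  where "V_quad k = (1 / complex_of_real (sqrt 2)) \<cdot>\<^sub>m
    four_block_mat (1\<^sub>m k) (1\<^sub>m k) ((- \<i>) \<cdot>\<^sub>m 1\<^sub>m k) (\<i> \<cdot>\<^sub>m 1\<^sub>m k)"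

text \<open>
  Right-hand side of the QSDE of a system operator \<open>X\<close> generated by \<open>Hop\<close> and \<open>L\<close> with input
  fields \<open>b\<close>. The product of a row $Y^\dagger$ with a column \<open>Z\<close> of operators is
  \<open>map_vec adj Y \<bullet> Z\<close>; \<open>\<bullet>\<close> keeps the order of the (noncommuting) factors.
\<close>

definition qsde_rhs ::
    "'a::complex_star_algebra \<Rightarrow> 'a vec \<Rightarrow> 'a vec \<Rightarrow> 'a \<Rightarrow> 'a"
  where "qsde_rhs Hop L b X =
    scaleC (- \<i>) (commutator X Hop)
    - scaleC (1 / 2)
        (map_vec adj (breve_vec L) \<bullet> (J_sig (dim_vec L) *\<^sub>o commutator_vec (breve_vec L) X))
    - map_vec adj (breve_vec b) \<bullet> (J_sig (dim_vec L) *\<^sub>o commutator_vec (breve_vec L) X)"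

text \<open>
  The QSDE is a formal equation (\<open>b\<close> is white noise), so the time derivative of operator
  processes is an arbitrary map \<open>ddt\<close> on which nothing is assumed. \<open>Hop\<close> and \<open>L\<close> depend on
  time because they are built from the evolving system operators.
\<close>

definition satisfies_qsde ::
    "((real \<Rightarrow> 'a::complex_star_algebra) \<Rightarrow> real \<Rightarrow> 'a) \<Rightarrow> (real \<Rightarrow> 'a) \<Rightarrow> (real \<Rightarrow> 'a vec)
      \<Rightarrow> (real \<Rightarrow> 'a vec) \<Rightarrow> (real \<Rightarrow> 'a) \<Rightarrow> bool"
  where "satisfies_qsde ddt Hop L b X \<longleftrightarrow> (\<forall>t. ddt X t = qsde_rhs (Hop t) (L t) (b t) (X t))"

definition ddt_vec ::
    "((real \<Rightarrow> 'a) \<Rightarrow> real \<Rightarrow> 'a) \<Rightarrow> (real \<Rightarrow> 'a vec) \<Rightarrow> real \<Rightarrow> 'a vec"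
  where "ddt_vec ddt x t = vec (dim_vec (x t)) (\<lambda>i. ddt (\<lambda>s. x s $ i) t)"

end

theory Submission
  imports Defs
begin

text \<open>
  Write \<open>J\<close> for the block diagonal symplectic form, \<open>K\<close> for the Hamiltonian matrix and \<open>\<Lambda>\<close> for
  $\breve\Gamma$. Commutators of entries of \<open>x\<close> are scalars, so the Leibniz rule and the symmetry
  of \<open>K\<close> give the drift \<open>J K x\<close> for the Hamiltonian part, and
  $[\Lambda x, x_i]$ is the $i$-th column of $\imath \Lambda J$. Exchanging the two halves of a
  doubled-up vector is its entrywise adjoint and turns $J_m$ into $-J_m$, whence
  $Y^\dagger J_m [\Lambda x, x_i]$ is the $i$-th entry of $\imath J \Lambda^\dagger J_m Y$ for every
  doubled-up \<open>Y\<close>. The dissipative drift is therefore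
  $-\frac{\imath}{2} J \Lambda^\dagger J_m \Lambda x$, and the input term is
  $-\imath J \Lambda^\dagger J_m \breve b = J \Lambda^\dagger V_m^\dagger \mathbb{J}_m u$ because
  $V_m^\dagger \mathbb{J}_m V_m = -\imath J_m$. The claim is the block form of these matrices.
\<close>

section \<open>Operators and numerical matrices\<close>

text \<open>The axioms on \<open>scaleC\<close> contain those of a complex module, so the library
  facts on zero, negatives, differences and sums carry over to operators.\<close>

lemma module_scaleC: "Modules.module (scaleC :: complex \<Rightarrow> 'a::complex_star_algebra \<Rightarrow> 'a)"
  by standard (simp_all add: scaleC_add_right scaleC_add_left scaleC_scaleC scaleC_one)

lemmas scaleC_zero_left [simp] = module.scale_zero_left[OF module_scaleC]
  and scaleC_minus_left = module.scale_minus_left[OF module_scaleC]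
  and scaleC_diff_left = module.scale_left_diff_distrib[OF module_scaleC]
  and scaleC_diff_right = module.scale_right_diff_distrib[OF module_scaleC]
  and scaleC_sum_right = module.scale_sum_right[OF module_scaleC]

text \<open>This makes the entrywise embedding of numerical matrices multiplicative, on which the
  associativity of \<open>*\<^sub>o\<close> rests.\<close>

lemma semiring_hom_of_cplx: "semiring_hom (of_cplx :: complex \<Rightarrow> 'a::complex_star_algebra)"
  by standard (simp_all add: of_cplx_def scaleC_add_left scaleC_one mult_scaleC_left scaleC_scaleC)

lemma of_cplx_sum: "of_cplx (sum f S) = (\<Sum>i\<in>S. of_cplx (f i))"
  unfolding of_cplx_def by (rule module.scale_sum_left[OF module_scaleC])

text \<open>Together with \<open>mult_of_cplx\<close> this says that numbers are central, so a
  commutator that is a number can be pulled out of a product from either side.\<close>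

lemma of_cplx_mult: "of_cplx c * a = scaleC c a"
  by (simp add: of_cplx_def mult_scaleC_left)

lemma mult_of_cplx: "a * of_cplx c = scaleC c a"
  by (simp add: of_cplx_def mult_scaleC_right)

lemma scaleC_of_cplx: "scaleC c (of_cplx d) = of_cplx (c * d)"
  by (simp add: of_cplx_def scaleC_scaleC)

lemma adj_zero: "adj (0::'a::complex_star_algebra) = 0"
  using adj_add[of 0 "0::'a"] by simp

lemma adj_sum: "adj (sum f S) = (\<Sum>i\<in>S. adj (f i :: 'a::complex_star_algebra))"
  by (induction S rule: infinite_finite_induct) (simp_all add: adj_zero adj_add)

text \<open>Leibniz rule: the commutator with a fixed operator is a derivation. The order of the
  factors is kept.\<close>

lemma commutator_mult_right: "commutator a (b * c) = commutator a b * c + b * commutator a c"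
  by (simp add: commutator_def algebra_simps)

lemma commutator_sum_right: "commutator a (sum f S) = (\<Sum>i\<in>S. commutator a (f i))"
  by (simp add: commutator_def sum_distrib_left sum_distrib_right sum_subtractf)

lemma commutator_sum_left: "commutator (sum f S) a = (\<Sum>i\<in>S. commutator (f i) a)"
  by (simp add: commutator_def sum_distrib_left sum_distrib_right sum_subtractf)

lemma commutator_scaleC_right: "commutator a (scaleC c b) = scaleC c (commutator a b)"
  by (simp add: commutator_def mult_scaleC_left mult_scaleC_right scaleC_diff_right)

lemma commutator_scaleC_left: "commutator (scaleC c a) b = scaleC c (commutator a b)"
  by (simp add: commutator_def mult_scaleC_left mult_scaleC_right scaleC_diff_right)

section \<open>The action of numerical matrices on vectors of operators\<close>

lemma dim_cmat_mult_vec[simp]: "dim_vec (M *\<^sub>o X) = dim_row M"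
  by (simp add: cmat_mult_vec_def)

lemma cmat_mult_vec_index:
  assumes "i < dim_row M" and "dim_vec X = dim_col M"
  shows "(M *\<^sub>o X) $ i = (\<Sum>j<dim_col M. scaleC (M $$ (i, j)) (X $ j))"
  using assms by (simp add: cmat_mult_vec_def scalar_prod_def of_cplx_mult atLeast0LessThan)

lemma cmat_mult_vec_assoc:
  assumes "dim_col A = dim_row B" and "dim_col B = dim_vec X"
  shows "(A * B) *\<^sub>o X = A *\<^sub>o (B *\<^sub>o X)"
proof -
  have hom: "map_mat of_cplx (A * B) = map_mat of_cplx A * (map_mat of_cplx B :: 'a mat)"
    by (rule semiring_hom.mat_hom_mult[OF semiring_hom_of_cplx, of _ "dim_row A" "dim_col A" _ "dim_col B"])
      (auto intro!: carrier_matI simp: assms(1))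
  show ?thesis
    unfolding cmat_mult_vec_def hom
    by (rule assoc_mult_mat_vec[of _ "dim_row A" "dim_col A" _ "dim_col B"])
      (auto intro!: carrier_matI carrier_vecI simp: assms)
qed

lemma cmat_mult_vec_diff:
  assumes "dim_row A = dim_row B" and "dim_col A = dim_col B" and "dim_col B = dim_vec X"
  shows "(A - B) *\<^sub>o X = A *\<^sub>o X - B *\<^sub>o X"
  using assms
  by (intro eq_vecI) (simp_all add: cmat_mult_vec_index scaleC_diff_left sum_subtractf)

lemma cmat_mult_vec_add_right:
  assumes "dim_col A = dim_vec X" and "dim_vec X = dim_vec Y"
  shows "A *\<^sub>o (X + Y) = A *\<^sub>o X + A *\<^sub>o Y"
  using assms
  by (intro eq_vecI) (simp_all add: cmat_mult_vec_index scaleC_add_right sum.distrib)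

lemma cmat_smult_mult_vec_index:
  assumes "i < dim_row A" and "dim_col A = dim_vec X"
  shows "((c \<cdot>\<^sub>m A) *\<^sub>o X) $ i = scaleC c ((A *\<^sub>o X) $ i)"
  using assms by (simp add: cmat_mult_vec_index scaleC_sum_right scaleC_scaleC)

text \<open>Associativity with equations between dimensions as premises: these follow by
  simplification, whereas carrier premises leave the dimensions to be guessed.\<close>

lemma mult_mat_assoc:
  "dim_col A = dim_row B \<Longrightarrow> dim_col B = dim_row C \<Longrightarrow> A * B * C = A * (B * C)"
  by (rule assoc_mult_mat[of _ "dim_row A" "dim_col A" _ "dim_col B" _ "dim_col C"])
    (auto intro!: carrier_matI)

lemma transpose_mult_mat:
  fixes A :: "'a::comm_semiring_0 mat"
  shows "dim_col A = dim_row B \<Longrightarrow> (A * B)\<^sup>T = B\<^sup>T * A\<^sup>T"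
  by (rule transpose_mult[of _ "dim_row A" "dim_col A" _ "dim_col B"]) (auto intro!: carrier_matI)

section \<open>Entries and dimensions of the doubled-up and structured matrices\<close>

lemma dagger_index[simp]:
  "i < dim_col A \<Longrightarrow> j < dim_row A \<Longrightarrow> dagger A $$ (i, j) = adj (A $$ (j, i))"
  "dim_row (dagger A) = dim_col A"
  "dim_col (dagger A) = dim_row A"
  by (simp_all add: dagger_def)

lemma breve_vec_index[simp]:
  "i < 2 * dim_vec X \<Longrightarrow>
    breve_vec X $ i = (if i < dim_vec X then X $ i else adj (X $ (i - dim_vec X)))"
  "dim_vec (breve_vec X) = 2 * dim_vec X"
  by (auto simp: breve_vec_def)

lemma append_rows_index[simp]:
  "i < dim_row A + dim_row B \<Longrightarrow> j < dim_col A \<Longrightarrow>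
    (A @\<^sub>r B) $$ (i, j) = (if i < dim_row A then A $$ (i, j) else B $$ (i - dim_row A, j))"
  "dim_row (A @\<^sub>r B) = dim_row A + dim_row B"
  "dim_col (A @\<^sub>r B) = dim_col A"
  by (simp_all add: append_rows_def)

lemma append_cols_index[simp]:
  "i < dim_row A \<Longrightarrow> j < dim_col A + dim_col B \<Longrightarrow>
    (A @\<^sub>c B) $$ (i, j) = (if j < dim_col A then A $$ (i, j) else B $$ (i, j - dim_col A))"
  "dim_row (A @\<^sub>c B) = dim_row A"
  "dim_col (A @\<^sub>c B) = dim_col A + dim_col B"
  by (simp_all add: append_cols_def)

lemma breve_mat_index[simp]:
  "i < 2 * dim_row A \<Longrightarrow> j < dim_col A \<Longrightarrow>
    breve_mat A $$ (i, j) = (if i < dim_row A then A $$ (i, j) else adj (A $$ (i - dim_row A, j)))"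
  "dim_row (breve_mat A) = 2 * dim_row A"
  "dim_col (breve_mat A) = dim_col A"
  by (auto simp: breve_mat_def)

lemma J_sig_index[simp]:
  "i < 2 * k \<Longrightarrow> j < 2 * k \<Longrightarrow>
    J_sig k $$ (i, j) = (if i = j then if i < k then 1 else - 1 else 0)"
  "dim_row (J_sig k) = 2 * k"
  "dim_col (J_sig k) = 2 * k"
  by (auto simp: J_sig_def)

lemma J_symp_index[simp]:
  "i < 2 * k \<Longrightarrow> j < 2 * k \<Longrightarrow>
    J_symp k $$ (i, j) = (if j = i + k then 1 else if i = j + k then - 1 else 0)"
  "dim_row (J_symp k) = 2 * k"
  "dim_col (J_symp k) = 2 * k"
  by (auto simp: J_symp_def)

lemma dim_V_quad[simp]: "dim_row (V_quad k) = 2 * k" "dim_col (V_quad k) = 2 * k"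
  by (auto simp: V_quad_def)

text \<open>When the entries of \<open>x\<close> are self-adjoint, taking adjoints of a linear
  combination only conjugates its coefficients, so the lower half is the conjugate of
  \<open>\<Gamma>\<close> applied to the same \<open>x\<close>.\<close>

lemma breve_vec_cmat_mult_vec:
  assumes "dim_vec x = dim_col \<Gamma>" and "\<And>i. i < dim_vec x \<Longrightarrow> adj (x $ i) = x $ i"
  shows "breve_vec (\<Gamma> *\<^sub>o x) = breve_mat \<Gamma> *\<^sub>o x"
  using assms
  by (intro eq_vecI)
    (auto simp: cmat_mult_vec_index adj_sum adj_scaleC adj_complex_def intro!: sum.cong)

section \<open>The swap of a doubled-up vector\<close>

text \<open>The symmetric permutation that exchanges the two halves. It serves to express the
  antilinear adjoint as a linear map on doubled-up vectors.\<close>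

definition swap_mat :: "nat \<Rightarrow> complex mat"
  where "swap_mat k = four_block_mat (0\<^sub>m k k) (1\<^sub>m k) (1\<^sub>m k) (0\<^sub>m k k)"

lemma swap_mat_index[simp]:
  "i < 2 * k \<Longrightarrow> j < 2 * k \<Longrightarrow>
    swap_mat k $$ (i, j) = (if j = i + k \<or> i = j + k then 1 else 0)"
  "dim_row (swap_mat k) = 2 * k"
  "dim_col (swap_mat k) = 2 * k"
  by (auto simp: swap_mat_def)

text \<open>Since \<open>adj\<close> is an involution, taking adjoints of the two halves returns the
  same halves in the opposite order.\<close>

lemma adj_breve_vec: "map_vec adj (breve_vec X) = swap_mat (dim_vec X) *\<^sub>o breve_vec X"
proof (intro eq_vecI)
  fix i assume "i < dim_vec (swap_mat (dim_vec X) *\<^sub>o breve_vec X)"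
  then have i: "i < 2 * dim_vec X" by simp
  \<comment> \<open>The column of the only nonzero entry in row \<open>i\<close> of the
    swap.\<close>
  let ?k = "if i < dim_vec X then i + dim_vec X else i - dim_vec X"
  have "(swap_mat (dim_vec X) *\<^sub>o breve_vec X) $ i =
      (\<Sum>j<2 * dim_vec X. scaleC (swap_mat (dim_vec X) $$ (i, j)) (breve_vec X $ j))"
    using cmat_mult_vec_index[of i "swap_mat (dim_vec X)" "breve_vec X"] i
    by (simp only: breve_vec_index(2) swap_mat_index(2,3))
  also have "\<dots> = (\<Sum>j<2 * dim_vec X. if ?k = j then breve_vec X $ j else 0)"
    using i by (intro sum.cong refl) (auto simp: scaleC_one)
  also have "\<dots> = breve_vec X $ ?k"
    using i by (subst sum.delta') auto
  finally show "map_vec adj (breve_vec X) $ i = (swap_mat (dim_vec X) *\<^sub>o breve_vec X) $ i"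
    using i by (auto simp: adj_adj)
qed simp

lemma swap_four_block:
  assumes "A \<in> carrier_mat k N" and "B \<in> carrier_mat k N"
  shows "swap_mat k * (A @\<^sub>r B) = B @\<^sub>r A"
  unfolding swap_mat_def append_rows_def using assms
  \<comment> \<open>Appended rows form a four-block matrix whose right blocks have width 0.\<close>
  by (subst mult_four_block_mat[where ?n1.0=k and ?n2.0=k and ?nc2.0=0]) auto

text \<open>Conjugation by the swap interchanges the diagonal blocks, which are negatives of each
  other.\<close>

lemma swap_J_sig_swap: "swap_mat k * J_sig k * swap_mat k = - J_sig k"
proof -
  have "swap_mat k * J_sig k = four_block_mat (0\<^sub>m k k) (- 1\<^sub>m k) (1\<^sub>m k) (0\<^sub>m k k)"
    unfolding swap_mat_def J_sig_def
    by (simp add: Let_def, subst mult_four_block_mat[where ?n1.0=k and ?n2.0=k]) auto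
  then show ?thesis
    unfolding swap_mat_def J_sig_def
    by (simp add: Let_def, subst mult_four_block_mat[where ?n1.0=k and ?n2.0=k])
      (auto intro!: eq_matI)
qed

text \<open>Exchanging the halves of the doubled-up matrix conjugates its entries, so its dagger is
  its transpose times the swap. The swap is its own inverse and moves to the other side.\<close>

lemma transpose_breve_mat:
  fixes \<Gamma> :: "complex mat"
  shows "(breve_mat \<Gamma>)\<^sup>T = dagger (breve_mat \<Gamma>) * swap_mat (dim_row \<Gamma>)"
proof -
  let ?m = "dim_row \<Gamma>"
  have P: "(swap_mat ?m)\<^sup>T = swap_mat ?m"
    by (intro eq_matI) auto
  have PP: "swap_mat ?m * swap_mat ?m = 1\<^sub>m (2 * ?m)"
    unfolding swap_mat_def
    by (subst mult_four_block_mat[where ?n1.0="?m" and ?n2.0="?m"]) (auto simp: mult_2)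
  have "dagger (breve_mat \<Gamma>) = (swap_mat ?m * breve_mat \<Gamma>)\<^sup>T"
    unfolding breve_mat_def
    by (subst swap_four_block[of _ _ "dim_col \<Gamma>"])
      (auto intro!: eq_matI simp: adj_complex_def)
  also have "\<dots> = (breve_mat \<Gamma>)\<^sup>T * swap_mat ?m"
    by (simp add: transpose_mult_mat P)
  finally have "dagger (breve_mat \<Gamma>) * swap_mat ?m = (breve_mat \<Gamma>)\<^sup>T * swap_mat ?m * swap_mat ?m"
    by simp
  also have "\<dots> = (breve_mat \<Gamma>)\<^sup>T * (swap_mat ?m * swap_mat ?m)"
    by (rule mult_mat_assoc) simp_all
  also have "\<dots> = (breve_mat \<Gamma>)\<^sup>T"
    unfolding PP by (rule right_mult_one_mat[of _ "dim_col \<Gamma>"]) (rule carrier_matI, simp_all)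
  finally show ?thesis ..
qed

text \<open>Passing to quadratures turns the symplectic form into a multiple of the signature. This
  is what allows the input term to be written with quadratures instead of fields.\<close>

lemma V_quad_J_symp_V_quad: "dagger (V_quad k) * J_symp k * V_quad k = (- \<i>) \<cdot>\<^sub>m J_sig k"
proof -
  \<comment> \<open>Of the normalisation, only that it is real and has square 1/2 enters the
    computation.\<close>
  define c where "c = 1 / complex_of_real (sqrt 2)"
  have c: "cnj c = c" "c * c = 1 / 2"
    unfolding c_def by (simp_all flip: of_real_mult)
  have c2: "c * (c * z) = z / 2" for z
    by (simp add: c flip: mult.assoc)
  have d: "dagger (V_quad k) = four_block_mat (c \<cdot>\<^sub>m 1\<^sub>m k) ((c * \<i>) \<cdot>\<^sub>m 1\<^sub>m k) (c \<cdot>\<^sub>m 1\<^sub>m k) ((- c * \<i>) \<cdot>\<^sub>m 1\<^sub>m k)"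
    unfolding V_quad_def c_def[symmetric] by (intro eq_matI) (auto simp: adj_complex_def c)
  have v: "V_quad k = four_block_mat (c \<cdot>\<^sub>m 1\<^sub>m k) (c \<cdot>\<^sub>m 1\<^sub>m k) ((- c * \<i>) \<cdot>\<^sub>m 1\<^sub>m k) ((c * \<i>) \<cdot>\<^sub>m 1\<^sub>m k)"
    unfolding V_quad_def c_def[symmetric] by (intro eq_matI) auto
  have s: "(- \<i>) \<cdot>\<^sub>m J_sig k = four_block_mat ((- \<i>) \<cdot>\<^sub>m 1\<^sub>m k) (0\<^sub>m k k) (0\<^sub>m k k) (\<i> \<cdot>\<^sub>m 1\<^sub>m k)"
    by (intro eq_matI) auto
  have "dagger (V_quad k) * J_symp k =
      four_block_mat ((- c * \<i>) \<cdot>\<^sub>m 1\<^sub>m k) (c \<cdot>\<^sub>m 1\<^sub>m k) ((c * \<i>) \<cdot>\<^sub>m 1\<^sub>m k) (c \<cdot>\<^sub>m 1\<^sub>m k)"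
    unfolding d J_symp_def
    by (subst mult_four_block_mat[where ?n1.0=k and ?n2.0=k]) (auto intro!: eq_matI)
  also have "\<dots> * V_quad k = (- \<i>) \<cdot>\<^sub>m J_sig k"
    unfolding v s
    by (subst mult_four_block_mat[where ?n1.0=k and ?n2.0=k])
      (auto intro!: cong_four_block_mat eq_matI simp: c c2 mult_ac)
  finally show ?thesis .
qed

section \<open>The equation of motion of a canonical vector\<close>

text \<open>The Leibniz rule gives one sum for each factor \<open>x\<close>, and the two sums
  coincide. The resulting factor 2 cancels the 1/2 in the Hamiltonian.\<close>

lemma commutator_quadratic:
  assumes x: "x \<in> carrier_vec N" and J: "J \<in> carrier_mat N N" and K: "K \<in> carrier_mat N N"
    and ccr: "\<And>j k. j < N \<Longrightarrow> k < N \<Longrightarrow> commutator (x $ j) (x $ k) = of_cplx (\<i> * J $$ (j, k))"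
    and sym: "K\<^sup>T = K" and i: "i < N"
  shows "commutator (x $ i) (x \<bullet> (K *\<^sub>o x)) = scaleC (2 * \<i>) (((J * K) *\<^sub>o x) $ i)"
proof -
  have K_sym: "K $$ (j, k) = K $$ (k, j)" if "j < N" "k < N" for j k
    using that K arg_cong[OF sym, of "\<lambda>M. M $$ (j, k)"] by simp
  let ?s = "\<lambda>j k. scaleC (\<i> * J $$ (i, j) * K $$ (j, k)) (x $ k)"
  have Jx: "scaleC \<i> (((J * K) *\<^sub>o x) $ i) = (\<Sum>j<N. \<Sum>k<N. ?s j k)"
    using x J K i
    by (simp add: cmat_mult_vec_assoc cmat_mult_vec_index scaleC_sum_right scaleC_scaleC mult_ac)
  have "commutator (x $ i) (x \<bullet> (K *\<^sub>o x)) =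
      (\<Sum>j<N. \<Sum>k<N. commutator (x $ i) (scaleC (K $$ (j, k)) (x $ j * x $ k)))"
    using x K
    by (simp add: scalar_prod_def cmat_mult_vec_index atLeast0LessThan sum_distrib_left
        commutator_sum_right mult_scaleC_right)
  \<comment> \<open>\<open>?s j k\<close> comes from the commutator with the left factor,
    \<open>?s k j\<close> from that with the right factor after using the symmetry of
    \<open>K\<close>.\<close>
  also have "\<dots> = (\<Sum>j<N. \<Sum>k<N. ?s j k + ?s k j)"
    using i
    by (intro sum.cong refl)
      (simp add: commutator_scaleC_right commutator_mult_right ccr of_cplx_mult mult_of_cplx
        scaleC_add_right scaleC_scaleC K_sym mult_ac)
  also have "\<dots> = (\<Sum>j<N. \<Sum>k<N. ?s j k) + (\<Sum>j<N. \<Sum>k<N. ?s k j)"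
    by (simp add: sum.distrib)
  also have "(\<Sum>j<N. \<Sum>k<N. ?s k j) = (\<Sum>j<N. \<Sum>k<N. ?s j k)"
    by (rule sum.swap)
  finally show ?thesis
    unfolding Jx[symmetric] mult_2 scaleC_add_left .
qed

text \<open>All entries of the commutator vector are numbers, hence commute with the entries of
  \<open>W\<close>. A row of operators times a numerical matrix is then the transposed matrix acting
  on the column, which is where the transpose comes from.\<close>

lemma scalar_prod_commutator:
  assumes x: "x \<in> carrier_vec N" and J: "J \<in> carrier_mat N N"
    and \<Lambda>: "\<Lambda> \<in> carrier_mat r N" and S: "S \<in> carrier_mat r r" and W: "W \<in> carrier_vec r"
    and ccr: "\<And>j k. j < N \<Longrightarrow> k < N \<Longrightarrow> commutator (x $ j) (x $ k) = of_cplx (\<i> * J $$ (j, k))"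
    and i: "i < N"
  shows "W \<bullet> (S *\<^sub>o commutator_vec (\<Lambda> *\<^sub>o x) (x $ i)) =
    scaleC \<i> (((S * \<Lambda> * J)\<^sup>T *\<^sub>o W) $ i)"
proof -
  have comm: "commutator_vec (\<Lambda> *\<^sub>o x) (x $ i) $ a = of_cplx (\<i> * (\<Lambda> * J) $$ (a, i))"
    if "a < r" for a
  proof -
    have "commutator_vec (\<Lambda> *\<^sub>o x) (x $ i) $ a = (\<Sum>k<N. of_cplx (\<Lambda> $$ (a, k) * (\<i> * J $$ (k, i))))"
      using that x \<Lambda> i
      by (simp add: commutator_vec_def cmat_mult_vec_index commutator_sum_left
          commutator_scaleC_left ccr scaleC_of_cplx)
    also have "\<dots> = of_cplx (\<i> * (\<Lambda> * J) $$ (a, i))"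
      unfolding of_cplx_sum[symmetric] using that J \<Lambda> i
      by (simp add: scalar_prod_def atLeast0LessThan sum_distrib_left mult_ac)
    finally show ?thesis .
  qed
  have scalar: "(S *\<^sub>o commutator_vec (\<Lambda> *\<^sub>o x) (x $ i)) $ a = of_cplx (\<i> * (S * \<Lambda> * J) $$ (a, i))"
    if "a < r" for a
  proof -
    have "(S *\<^sub>o commutator_vec (\<Lambda> *\<^sub>o x) (x $ i)) $ a =
        (\<Sum>k<r. scaleC (S $$ (a, k)) (commutator_vec (\<Lambda> *\<^sub>o x) (x $ i) $ k))"
      using that \<Lambda> S by (subst cmat_mult_vec_index) (auto simp: commutator_vec_def)
    also have "\<dots> = (\<Sum>k<r. of_cplx (S $$ (a, k) * (\<i> * (\<Lambda> * J) $$ (k, i))))"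
      \<comment> \<open>The entry of the product stays folded, so that the remaining sum can be read
        as a product with \<open>S\<close>.\<close>
      by (intro sum.cong refl) (simp add: comm scaleC_of_cplx del: index_mult_mat(1))
    also have "\<dots> = of_cplx (\<i> * (\<Sum>k<r. S $$ (a, k) * (\<Lambda> * J) $$ (k, i)))"
      unfolding of_cplx_sum[symmetric] sum_distrib_left by (simp only: mult.left_commute)
    also have "(\<Sum>k<r. S $$ (a, k) * (\<Lambda> * J) $$ (k, i)) = (S * (\<Lambda> * J)) $$ (a, i)"
      using that J \<Lambda> S i
      by (subst index_mult_mat(1)) (auto simp: scalar_prod_def atLeast0LessThan)
    also have "S * (\<Lambda> * J) = S * \<Lambda> * J"
      using J \<Lambda> S by simp
    finally show ?thesis .
  qed
  have "W \<bullet> (S *\<^sub>o commutator_vec (\<Lambda> *\<^sub>o x) (x $ i)) =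
      (\<Sum>a<r. scaleC (\<i> * (S * \<Lambda> * J) $$ (a, i)) (W $ a))"
    unfolding scalar_prod_def using S
    by (simp add: atLeast0LessThan scalar mult_of_cplx del: index_mult_mat(1))
  also have "\<dots> = scaleC \<i> (((S * \<Lambda> * J)\<^sup>T *\<^sub>o W) $ i)"
    using J S W i
    by (simp add: cmat_mult_vec_index scaleC_sum_right scaleC_scaleC del: index_mult_mat(1))
  finally show ?thesis .
qed

text \<open>Two signs cancel: one from the skewness of \<open>J\<close>, the other from conjugating
  \<open>J_sig m\<close> by the swap. \<open>X\<close> is left general because it stands for the
  coupling operators in the dissipative term and for the fields in the input term.\<close>

lemma coupling_term:
  assumes x: "x \<in> carrier_vec N" and J: "J \<in> carrier_mat N N" and skew: "J\<^sup>T = - J"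
    and \<Gamma>: "\<Gamma> \<in> carrier_mat m N" and X: "X \<in> carrier_vec m"
    and ccr: "\<And>j k. j < N \<Longrightarrow> k < N \<Longrightarrow> commutator (x $ j) (x $ k) = of_cplx (\<i> * J $$ (j, k))"
    and i: "i < N"
  shows "map_vec adj (breve_vec X) \<bullet> (J_sig m *\<^sub>o commutator_vec (breve_mat \<Gamma> *\<^sub>o x) (x $ i)) =
    scaleC \<i> (((J * dagger (breve_mat \<Gamma>) * J_sig m) *\<^sub>o breve_vec X) $ i)"
proof -
  let ?\<Lambda> = "breve_mat \<Gamma>" and ?P = "swap_mat m" and ?S = "J_sig m"
  let ?D = "dagger ?\<Lambda>"
  have dims: "dim_row J = N" "dim_col J = N" "dim_row \<Gamma> = m" "dim_col \<Gamma> = N" "dim_vec X = m"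
    using J \<Gamma> X by auto
  have S: "?S\<^sup>T = ?S"
    by (intro eq_matI) auto
  have "(?S * ?\<Lambda> * J)\<^sup>T = J\<^sup>T * (?\<Lambda>\<^sup>T * ?S\<^sup>T)"
    by (simp add: transpose_mult_mat dims del: assoc_mult_mat)
  also have "\<dots> = - (J * (?D * ?P * ?S))"
    unfolding skew S transpose_breve_mat dims(3) by (rule uminus_mult_left_mat) (simp add: dims)
  also have "\<dots> * ?P = - (J * (?D * ?P * ?S) * ?P)"
    by (rule uminus_mult_left_mat) simp
  also have "J * (?D * ?P * ?S) * ?P = J * (?D * (?P * ?S * ?P))"
    by (simp add: mult_mat_assoc dims del: assoc_mult_mat)
  also have "?D * (?P * ?S * ?P) = - (?D * ?S)"
    unfolding swap_J_sig_swap by (rule uminus_mult_right_mat) (simp add: dims)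
  also have "- (J * - (?D * ?S)) = J * ?D * ?S"
    by (simp add: mult_mat_assoc dims del: assoc_mult_mat)
  finally have "(?S * ?\<Lambda> * J)\<^sup>T * ?P = J * ?D * ?S" .
  then have *: "(?S * ?\<Lambda> * J)\<^sup>T *\<^sub>o (?P *\<^sub>o breve_vec X) = (J * ?D * ?S) *\<^sub>o breve_vec X"
    by (simp add: dims del: assoc_mult_mat flip: cmat_mult_vec_assoc)
  show ?thesis
    \<comment> \<open>The adjoint row becomes the swap applied to \<open>breve_vec X\<close>, which
      takes the role of \<open>W\<close>.\<close>
    unfolding *[symmetric] adj_breve_vec dims(5)
    by (rule scalar_prod_commutator[OF x J _ _ _ ccr i])
      (auto intro!: carrier_matI carrier_vecI simp: dims)
qed

text \<open>The scalars combine as follows: \<open>- \<i>\<close>, 1/2 and \<open>2 * \<i>\<close>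
  multiply to 1 in the Hamiltonian term, -1/2 and \<open>\<i>\<close> to \<open>- \<i> / 2\<close>
  in the dissipative term, and the input term keeps \<open>- \<i>\<close>.\<close>

lemma qsde_rhs_canonical:
  assumes x: "x \<in> carrier_vec N" and J: "J \<in> carrier_mat N N" and skew: "J\<^sup>T = - J"
    and ccr: "\<And>j k. j < N \<Longrightarrow> k < N \<Longrightarrow> commutator (x $ j) (x $ k) = of_cplx (\<i> * J $$ (j, k))"
    and selfadjoint: "\<And>j. j < N \<Longrightarrow> adj (x $ j) = x $ j"
    and K: "K \<in> carrier_mat N N" and K_sym: "K\<^sup>T = K"
    and \<Gamma>: "\<Gamma> \<in> carrier_mat m N" and b: "b \<in> carrier_vec m" and i: "i < N"
  defines "\<Lambda> \<equiv> breve_mat \<Gamma>"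
  shows "qsde_rhs (scaleC (1 / 2) (x \<bullet> (K *\<^sub>o x))) (\<Gamma> *\<^sub>o x) b (x $ i) =
    ((J * K - (\<i> / 2) \<cdot>\<^sub>m (J * dagger \<Lambda> * J_sig m * \<Lambda>)) *\<^sub>o x
      + (J * dagger \<Lambda> * (dagger (V_quad m) * J_symp m)) *\<^sub>o (V_quad m *\<^sub>o breve_vec b)) $ i"
proof -
  have [simp]: "dim_row \<Lambda> = 2 * m" "dim_col \<Lambda> = N" "dim_vec x = N" "dim_vec b = m"
    "dim_row J = N" "dim_col J = N" "dim_row K = N" "dim_col K = N"
    using \<Gamma> x b J K by (auto simp: \<Lambda>_def)
  have L: "breve_vec (\<Gamma> *\<^sub>o x) = \<Lambda> *\<^sub>o x"
    unfolding \<Lambda>_def using \<Gamma> selfadjoint by (intro breve_vec_cmat_mult_vec) auto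
  have [simp]: "dim_row \<Gamma> = m" using \<Gamma> by simp
  have coupling: "map_vec adj (breve_vec X) \<bullet> (J_sig m *\<^sub>o commutator_vec (\<Lambda> *\<^sub>o x) (x $ i)) =
      scaleC \<i> (((J * dagger \<Lambda> * J_sig m) *\<^sub>o breve_vec X) $ i)" if "X \<in> carrier_vec m" for X
    unfolding \<Lambda>_def by (rule coupling_term[OF x J skew \<Gamma> that ccr i])
  have hamiltonian: "commutator (x $ i) (x \<bullet> (K *\<^sub>o x)) = scaleC (2 * \<i>) (((J * K) *\<^sub>o x) $ i)"
    by (rule commutator_quadratic[OF x J K ccr K_sym i])
  \<comment> \<open>The input term is computed from the quadrature side: regrouping isolates the
    product that \<open>V_quad_J_symp_V_quad\<close> collapses.\<close>
  have "J * dagger \<Lambda> * (dagger (V_quad m) * J_symp m) * V_quad m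
      = J * dagger \<Lambda> * (dagger (V_quad m) * J_symp m * V_quad m)"
    by (rule mult_mat_assoc) simp_all
  also have "\<dots> = (- \<i>) \<cdot>\<^sub>m (J * dagger \<Lambda> * J_sig m)"
    unfolding V_quad_J_symp_V_quad
    by (rule mult_smult_distrib[of _ N "2 * m" _ "2 * m"]) (auto intro!: carrier_matI)
  finally have V: "J * dagger \<Lambda> * (dagger (V_quad m) * J_symp m) * V_quad m
      = (- \<i>) \<cdot>\<^sub>m (J * dagger \<Lambda> * J_sig m)" .
  have "(J * dagger \<Lambda> * (dagger (V_quad m) * J_symp m)) *\<^sub>o (V_quad m *\<^sub>o breve_vec b)
      = (J * dagger \<Lambda> * (dagger (V_quad m) * J_symp m) * V_quad m) *\<^sub>o breve_vec b"
    by (rule cmat_mult_vec_assoc[symmetric]) simp_all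
  then have b_term: "((J * dagger \<Lambda> * (dagger (V_quad m) * J_symp m)) *\<^sub>o (V_quad m *\<^sub>o breve_vec b)) $ i
      = scaleC (- \<i>) (((J * dagger \<Lambda> * J_sig m) *\<^sub>o breve_vec b) $ i)"
    unfolding V using i by (simp add: cmat_smult_mult_vec_index scaleC_minus_left del: assoc_mult_mat)
  have "(J * dagger \<Lambda> * J_sig m * \<Lambda>) *\<^sub>o x = (J * dagger \<Lambda> * J_sig m) *\<^sub>o (\<Lambda> *\<^sub>o x)"
    by (rule cmat_mult_vec_assoc) simp_all
  then have x_term: "((J * K - (\<i> / 2) \<cdot>\<^sub>m (J * dagger \<Lambda> * J_sig m * \<Lambda>)) *\<^sub>o x) $ i =
      ((J * K) *\<^sub>o x) $ i - scaleC (\<i> / 2) (((J * dagger \<Lambda> * J_sig m) *\<^sub>o (\<Lambda> *\<^sub>o x)) $ i)"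
    using i by (simp add: cmat_mult_vec_diff cmat_smult_mult_vec_index del: assoc_mult_mat)
  have "\<Gamma> *\<^sub>o x \<in> carrier_vec m"
    by (rule carrier_vecI) simp
  note L_coupling = coupling[OF this, unfolded L]
  have "qsde_rhs (scaleC (1 / 2) (x \<bullet> (K *\<^sub>o x))) (\<Gamma> *\<^sub>o x) b (x $ i) =
      ((J * K) *\<^sub>o x) $ i - scaleC (\<i> / 2) (((J * dagger \<Lambda> * J_sig m) *\<^sub>o (\<Lambda> *\<^sub>o x)) $ i)
      - scaleC \<i> (((J * dagger \<Lambda> * J_sig m) *\<^sub>o breve_vec b) $ i)"
    unfolding qsde_rhs_def commutator_scaleC_right L hamiltonian dim_cmat_mult_vec \<open>dim_row \<Gamma> = m\<close>
      coupling[OF b] L_coupling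
    by (simp add: scaleC_scaleC scaleC_one scaleC_minus_left del: assoc_mult_mat)
  then show ?thesis
    using i by (simp add: x_term b_term scaleC_minus_left del: assoc_mult_mat)
qed


section \<open>Block matrices\<close>

lemma append_rows_mult:
  assumes "dim_col A = dim_row C" and "dim_col B = dim_row C"
  shows "(A @\<^sub>r B) * C = (A * C) @\<^sub>r (B * C)"
proof (intro eq_matI)
  fix i j assume "i < dim_row ((A * C) @\<^sub>r (B * C))" and "j < dim_col ((A * C) @\<^sub>r (B * C))"
  moreover from this have "row (A @\<^sub>r B) i = (if i < dim_row A then row A i else row B (i - dim_row A))"
    using assms by (intro eq_vecI) auto
  ultimately show "((A @\<^sub>r B) * C) $$ (i, j) = ((A * C) @\<^sub>r (B * C)) $$ (i, j)"
    by auto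
qed auto

lemma mult_append_cols:
  assumes "dim_col A = dim_row B" and "dim_row C = dim_row B"
  shows "A * (B @\<^sub>c C) = (A * B) @\<^sub>c (A * C)"
proof (intro eq_matI)
  fix i j assume "i < dim_row ((A * B) @\<^sub>c (A * C))" and "j < dim_col ((A * B) @\<^sub>c (A * C))"
  moreover from this have "col (B @\<^sub>c C) j = (if j < dim_col B then col B j else col C (j - dim_col B))"
    using assms by (intro eq_vecI) auto
  ultimately show "(A * (B @\<^sub>c C)) $$ (i, j) = ((A * B) @\<^sub>c (A * C)) $$ (i, j)"
    by auto
qed auto

lemma append_rows_minus:
  fixes A :: "'a::group_add mat"
  assumes "dim_row A = dim_row C" and "dim_col A = dim_col C"
    and "dim_row B = dim_row D" and "dim_col B = dim_col D" and "dim_col A = dim_col B"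
  shows "(A @\<^sub>r B) - (C @\<^sub>r D) = (A - C) @\<^sub>r (B - D)"
  using assms by (intro eq_matI) auto

lemma append_cols_minus:
  fixes A :: "'a::group_add mat"
  assumes "dim_row A = dim_row C" and "dim_col A = dim_col C"
    and "dim_row B = dim_row D" and "dim_col B = dim_col D" and "dim_row A = dim_row B"
  shows "(A @\<^sub>c B) - (C @\<^sub>c D) = (A - C) @\<^sub>c (B - D)"
  using assms by (intro eq_matI) auto

lemma uminus_append_cols:
  fixes A :: "'a::group_add mat"
  shows "dim_row A = dim_row B \<Longrightarrow> - (A @\<^sub>c B) = (- A) @\<^sub>c (- B)"
  by (intro eq_matI) auto

lemma smult_append_rows:
  fixes A :: "'a::mult_zero mat"
  shows "dim_col A = dim_col B \<Longrightarrow> c \<cdot>\<^sub>m (A @\<^sub>r B) = (c \<cdot>\<^sub>m A) @\<^sub>r (c \<cdot>\<^sub>m B)"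
  by (intro eq_matI) auto

lemma smult_append_cols:
  fixes A :: "'a::mult_zero mat"
  shows "dim_row A = dim_row B \<Longrightarrow> c \<cdot>\<^sub>m (A @\<^sub>c B) = (c \<cdot>\<^sub>m A) @\<^sub>c (c \<cdot>\<^sub>m B)"
  by (intro eq_matI) auto

lemma map_append_rows:
  "dim_col A = dim_col B \<Longrightarrow> map_mat f (A @\<^sub>r B) = map_mat f A @\<^sub>r map_mat f B"
  by (intro eq_matI) auto

lemma map_append_cols:
  "dim_row A = dim_row B \<Longrightarrow> map_mat f (A @\<^sub>c B) = map_mat f A @\<^sub>c map_mat f B"
  by (intro eq_matI) auto

lemma dagger_append_cols:
  "dim_row A = dim_row B \<Longrightarrow> dagger (A @\<^sub>c B) = dagger A @\<^sub>r dagger B"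
  by (intro eq_matI) auto

lemma dagger_zero_mat: "dagger (0\<^sub>m nr nc) = 0\<^sub>m nc nr"
  by (intro eq_matI) (auto simp: adj_zero)

lemma append_rows_assoc:
  "dim_col A = dim_col B \<Longrightarrow> dim_col B = dim_col C \<Longrightarrow> (A @\<^sub>r B) @\<^sub>r C = A @\<^sub>r B @\<^sub>r C"
  by (intro eq_matI) auto

text \<open>The sizes of the zero blocks are spelled as in the recursion of
  \<open>diag_block_mat\<close>, so that the rule matches its unfolding.\<close>

lemma diag_four_block_mult:
  fixes A :: "'a::semiring_0 mat"
  assumes "dim_col A = dim_row C" and "dim_col B = dim_row D" and "dim_col C = dim_col D"
  shows "four_block_mat A (0\<^sub>m (dim_row A) (dim_col B)) (0\<^sub>m (dim_row B) (dim_col A)) B * (C @\<^sub>r D)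
    = (A * C) @\<^sub>r (B * D)"
  unfolding append_rows_def using assms
  by (subst mult_four_block_mat[of _ "dim_row A" "dim_col A" _ "dim_col B" _ "dim_row B" _ _
        "dim_col C" _ 0]) (auto intro!: carrier_matI cong_four_block_mat eq_matI)

lemma J_symp_mult:
  assumes "dim_row A = k" and "dim_row B = k" and "dim_col A = dim_col B"
  shows "J_symp k * (A @\<^sub>r B) = B @\<^sub>r (- A)"
  unfolding append_rows_def J_symp_def using assms
  by (subst mult_four_block_mat[of _ k k _ k _ k _ _ "dim_col B" _ 0])
    (auto intro!: carrier_matI cong_four_block_mat eq_matI)

text \<open>The first symplectic block is multiplied out because the q and p parts of the h
  variables are separate blocks of the partition; the other two act on undivided blocks.\<close>

lemma symplectic_form_mult:
  assumes "dim_row A = k" and "dim_row B = k" and "dim_row C = 2 * n" and "dim_row D = 2 * m"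
    and "dim_col A = dim_col D" and "dim_col B = dim_col D" and "dim_col C = dim_col D"
  shows "diag_block_mat [J_symp k, J_symp n, J_symp m] * (A @\<^sub>r B @\<^sub>r C @\<^sub>r D)
    = B @\<^sub>r (- A) @\<^sub>r (J_symp n * C) @\<^sub>r (J_symp m * D)"
proof -
  let ?E = "four_block_mat (J_symp n) (0\<^sub>m (dim_row (J_symp n)) (dim_col (J_symp m)))
    (0\<^sub>m (dim_row (J_symp m)) (dim_col (J_symp n))) (J_symp m)"
  have E: "?E * (C @\<^sub>r D) = (J_symp n * C) @\<^sub>r (J_symp m * D)"
    using assms by (intro diag_four_block_mult) auto
  have "diag_block_mat [J_symp k, J_symp n, J_symp m] =
      four_block_mat (J_symp k) (0\<^sub>m (dim_row (J_symp k)) (dim_col ?E))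
        (0\<^sub>m (dim_row ?E) (dim_col (J_symp k))) ?E"
    \<comment> \<open>The recursion is unfolded for the first two blocks only; the singleton rule
      ends it without an empty block.\<close>
    unfolding diag_block_mat.simps(2)[of "J_symp k"] diag_block_mat.simps(2)[of "J_symp n"]
      diag_block_mat_singleton Let_def ..
  moreover have "A @\<^sub>r B @\<^sub>r C @\<^sub>r D = (A @\<^sub>r B) @\<^sub>r (C @\<^sub>r D)"
    using assms by (intro append_rows_assoc[symmetric]) auto
  ultimately have "diag_block_mat [J_symp k, J_symp n, J_symp m] * (A @\<^sub>r B @\<^sub>r C @\<^sub>r D)
      = (J_symp k * (A @\<^sub>r B)) @\<^sub>r (?E * (C @\<^sub>r D))"
    using assms by (simp only:) (intro diag_four_block_mult; auto)
  also have "\<dots> = (B @\<^sub>r (- A)) @\<^sub>r (J_symp n * C) @\<^sub>r (J_symp m * D)"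
    unfolding E using assms by (subst J_symp_mult) auto
  also have "\<dots> = B @\<^sub>r (- A) @\<^sub>r (J_symp n * C) @\<^sub>r (J_symp m * D)"
    using assms by (intro append_rows_assoc) auto
  finally show ?thesis .
qed

lemma diag_block_mat_skew:
  fixes As :: "'a::group_add mat list"
  assumes "\<And>A. A \<in> set As \<Longrightarrow> A\<^sup>T = - A"
  shows "(diag_block_mat As)\<^sup>T = - diag_block_mat As"
  using assms
proof (induction As)
  case (Cons A As)
  let ?B = "diag_block_mat As"
  have A: "A\<^sup>T = - A" and B: "?B\<^sup>T = - ?B"
    using Cons by auto
  \<comment> \<open>Skewness forces square blocks, so the off-diagonal zero blocks keep their sizes
    under transposition.\<close>
  have "dim_row A = dim_col A" "dim_row ?B = dim_col ?B"
    using arg_cong[OF A, of dim_row] arg_cong[OF B, of dim_row] by simp_all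
  then have "(diag_block_mat (A # As))\<^sup>T =
      four_block_mat (A\<^sup>T) (0\<^sub>m (dim_row A) (dim_col ?B)) (0\<^sub>m (dim_row ?B) (dim_col A)) (?B\<^sup>T)"
    unfolding diag_block_mat.simps Let_def
    by (subst transpose_four_block_mat[of _ "dim_row A" "dim_col A" _ "dim_col ?B" _ "dim_row ?B"])
      (auto intro!: carrier_matI)
  then show ?case
    unfolding A B by (simp add: Let_def) (intro eq_matI; auto)
qed (auto intro!: eq_matI)

lemma J_symp_skew: "(J_symp k)\<^sup>T = - J_symp k"
  by (intro eq_matI) auto

section \<open>Zero blocks and the block form of the drift and input matrices\<close>

lemma uminus_zero_mat: "- 0\<^sub>m nr nc = (0\<^sub>m nr nc :: 'a::group_add mat)"
  by (intro eq_matI) auto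

lemma smult_zero_right_mat: "c \<cdot>\<^sub>m 0\<^sub>m nr nc = (0\<^sub>m nr nc :: 'a::mult_zero mat)"
  by (intro eq_matI) auto

lemma minus_zero_right_mat:
  fixes A :: "'a::group_add mat"
  shows "dim_row A = nr \<Longrightarrow> dim_col A = nc \<Longrightarrow> A - 0\<^sub>m nr nc = A"
  by (intro eq_matI) auto

text \<open>Kept out of \<open>block_simps\<close> because it merges adjacent zero blocks; it serves
  to compare an undivided zero row with its partition.\<close>

lemma zero_append_cols: "0\<^sub>m nr nc @\<^sub>c 0\<^sub>m nr nc' = 0\<^sub>m nr (nc + nc')"
  by (intro eq_matI) auto

lemmas block_simps = append_rows_mult mult_append_cols append_rows_minus append_cols_minus
  uminus_append_cols smult_append_rows smult_append_cols symplectic_form_mult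
  dagger_append_cols dagger_zero_mat uminus_zero_mat smult_zero_right_mat minus_zero_right_mat

text \<open>The zero columns of the doubled-up coupling matrix become the zero rows. The factor
  \<open>Q\<close> is general: it is \<open>J_sig m\<close> for the drift and
  \<open>dagger (V_quad m) * J_symp m\<close> for the input matrix.\<close>

lemma input_blocks:
  assumes [simp]: "dim_row G = 2 * m" "dim_col G = n\<^sub>3" "dim_row F = 2 * m" "dim_col F = 2 * n\<^sub>1"
    and [simp]: "dim_row Q = 2 * m" "dim_col Q = 2 * m"
  shows "diag_block_mat [J_symp n\<^sub>3, J_symp n\<^sub>1, J_symp n\<^sub>2]
      * dagger (0\<^sub>m (2 * m) n\<^sub>3 @\<^sub>c G @\<^sub>c F @\<^sub>c 0\<^sub>m (2 * m) (2 * n\<^sub>2)) * Q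
    = (dagger G * Q) @\<^sub>r 0\<^sub>m n\<^sub>3 (2 * m) @\<^sub>r (J_symp n\<^sub>1 * dagger F * Q) @\<^sub>r 0\<^sub>m (2 * n\<^sub>2) (2 * m)"
  by (simp add: block_simps del: assoc_mult_mat diag_block_mat.simps)

text \<open>The coupling contributes only to the first and third block rows and the second and third
  block columns; all other blocks come from the Hamiltonian alone.\<close>

lemma drift_blocks:
  fixes H12 H22 K12 K13 Kco Kcc :: "complex mat" and n\<^sub>1 n\<^sub>2 n\<^sub>3 m :: nat
  assumes [simp]: "dim_row H12 = n\<^sub>3" "dim_col H12 = n\<^sub>3" "dim_row H22 = n\<^sub>3" "dim_col H22 = n\<^sub>3"
    "dim_row K12 = n\<^sub>3" "dim_col K12 = 2 * n\<^sub>1" "dim_row K13 = n\<^sub>3" "dim_col K13 = 2 * n\<^sub>2"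
    "dim_row Kco = 2 * n\<^sub>1" "dim_col Kco = 2 * n\<^sub>1" "dim_row Kcc = 2 * n\<^sub>2" "dim_col Kcc = 2 * n\<^sub>2"
    "dim_row G = 2 * m" "dim_col G = n\<^sub>3" "dim_row F = 2 * m" "dim_col F = 2 * n\<^sub>1"
  defines "J \<equiv> diag_block_mat [J_symp n\<^sub>3, J_symp n\<^sub>1, J_symp n\<^sub>2]"
    and "\<Lambda> \<equiv> 0\<^sub>m (2 * m) n\<^sub>3 @\<^sub>c G @\<^sub>c F @\<^sub>c 0\<^sub>m (2 * m) (2 * n\<^sub>2)"
  shows "J * ((0\<^sub>m n\<^sub>3 n\<^sub>3       @\<^sub>c H12  @\<^sub>c 0\<^sub>m n\<^sub>3 (2 * n\<^sub>1)       @\<^sub>c 0\<^sub>m n\<^sub>3 (2 * n\<^sub>2))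
      @\<^sub>r (H12\<^sup>T          @\<^sub>c H22  @\<^sub>c K12                  @\<^sub>c K13)
      @\<^sub>r (0\<^sub>m (2 * n\<^sub>1) n\<^sub>3 @\<^sub>c K12\<^sup>T @\<^sub>c Kco                  @\<^sub>c 0\<^sub>m (2 * n\<^sub>1) (2 * n\<^sub>2))
      @\<^sub>r (0\<^sub>m (2 * n\<^sub>2) n\<^sub>3 @\<^sub>c K13\<^sup>T @\<^sub>c 0\<^sub>m (2 * n\<^sub>2) (2 * n\<^sub>1) @\<^sub>c Kcc))
      - c \<cdot>\<^sub>m (J * dagger \<Lambda> * J_sig m * \<Lambda>) =
         (H12\<^sup>T @\<^sub>c (H22 - c \<cdot>\<^sub>m (dagger G * J_sig m * G)) @\<^sub>c (K12 - c \<cdot>\<^sub>m (dagger G * J_sig m * F)) @\<^sub>c K13)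
      @\<^sub>r (0\<^sub>m n\<^sub>3 n\<^sub>3 @\<^sub>c - H12 @\<^sub>c 0\<^sub>m n\<^sub>3 (2 * n\<^sub>1) @\<^sub>c 0\<^sub>m n\<^sub>3 (2 * n\<^sub>2))
      @\<^sub>r (0\<^sub>m (2 * n\<^sub>1) n\<^sub>3
          @\<^sub>c (J_symp n\<^sub>1 * K12\<^sup>T - c \<cdot>\<^sub>m (J_symp n\<^sub>1 * dagger F * J_sig m * G))
          @\<^sub>c (J_symp n\<^sub>1 * Kco - c \<cdot>\<^sub>m (J_symp n\<^sub>1 * dagger F * J_sig m * F))
          @\<^sub>c 0\<^sub>m (2 * n\<^sub>1) (2 * n\<^sub>2))
      @\<^sub>r (0\<^sub>m (2 * n\<^sub>2) n\<^sub>3 @\<^sub>c J_symp n\<^sub>2 * K13\<^sup>T @\<^sub>c 0\<^sub>m (2 * n\<^sub>2) (2 * n\<^sub>1) @\<^sub>c J_symp n\<^sub>2 * Kcc)"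
proof -
  have "J * dagger \<Lambda> * J_sig m = (dagger G * J_sig m) @\<^sub>r 0\<^sub>m n\<^sub>3 (2 * m)
      @\<^sub>r (J_symp n\<^sub>1 * dagger F * J_sig m) @\<^sub>r 0\<^sub>m (2 * n\<^sub>2) (2 * m)"
    unfolding J_def \<Lambda>_def by (rule input_blocks) simp_all
  moreover have "dim_row \<Lambda> = 2 * m"
    by (simp add: \<Lambda>_def)
  ultimately have "J * dagger \<Lambda> * J_sig m * \<Lambda> = (dagger G * J_sig m * \<Lambda>) @\<^sub>r 0\<^sub>m n\<^sub>3 (dim_col \<Lambda>)
      @\<^sub>r (J_symp n\<^sub>1 * dagger F * J_sig m * \<Lambda>) @\<^sub>r 0\<^sub>m (2 * n\<^sub>2) (dim_col \<Lambda>)"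
    by (simp add: append_rows_mult del: assoc_mult_mat)
  \<comment> \<open>The zero rows are partitioned like the Hamiltonian part, so that the subtraction
    proceeds block by block.\<close>
  also have "\<dots> =
         (0\<^sub>m n\<^sub>3 n\<^sub>3 @\<^sub>c dagger G * J_sig m * G @\<^sub>c dagger G * J_sig m * F @\<^sub>c 0\<^sub>m n\<^sub>3 (2 * n\<^sub>2))
      @\<^sub>r (0\<^sub>m n\<^sub>3 n\<^sub>3 @\<^sub>c 0\<^sub>m n\<^sub>3 n\<^sub>3 @\<^sub>c 0\<^sub>m n\<^sub>3 (2 * n\<^sub>1) @\<^sub>c 0\<^sub>m n\<^sub>3 (2 * n\<^sub>2))
      @\<^sub>r (0\<^sub>m (2 * n\<^sub>1) n\<^sub>3 @\<^sub>c J_symp n\<^sub>1 * dagger F * J_sig m * G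
          @\<^sub>c J_symp n\<^sub>1 * dagger F * J_sig m * F @\<^sub>c 0\<^sub>m (2 * n\<^sub>1) (2 * n\<^sub>2))
      @\<^sub>r (0\<^sub>m (2 * n\<^sub>2) n\<^sub>3 @\<^sub>c 0\<^sub>m (2 * n\<^sub>2) n\<^sub>3 @\<^sub>c 0\<^sub>m (2 * n\<^sub>2) (2 * n\<^sub>1) @\<^sub>c 0\<^sub>m (2 * n\<^sub>2) (2 * n\<^sub>2))"
    by (simp add: \<Lambda>_def block_simps zero_append_cols del: assoc_mult_mat)
  finally show ?thesis
    by (simp add: J_def block_simps del: assoc_mult_mat diag_block_mat.simps)
qed

section \<open>The partitioned equations of motion and the outputs\<close>

theorem lemma3p3:
  fixes n\<^sub>1 n\<^sub>2 n\<^sub>3 n m :: nat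
    and ddt :: "(real \<Rightarrow> 'a::complex_star_algebra) \<Rightarrow> real \<Rightarrow> 'a"
    and q\<^sub>h p\<^sub>h x\<^sub>c\<^sub>o x\<^sub>c\<^sub>c x b b\<^sub>o\<^sub>u\<^sub>t u y L :: "real \<Rightarrow> 'a vec"
    and Hop :: "real \<Rightarrow> 'a"
    and H H\<^sub>h12 H\<^sub>h22 H\<^sub>12 H\<^sub>13 H\<^sub>c\<^sub>o H\<^sub>c\<^sub>c :: "real mat"
    and \<Gamma> \<Gamma>\<^sub>h \<Gamma>\<^sub>c\<^sub>o :: "complex mat"
  assumes n: "n = n\<^sub>1 + n\<^sub>2 + n\<^sub>3"
    \<comment> \<open>system variables\<close>
    and q\<^sub>h: "\<And>t. q\<^sub>h t \<in> carrier_vec n\<^sub>3"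
    and p\<^sub>h: "\<And>t. p\<^sub>h t \<in> carrier_vec n\<^sub>3"
    and x\<^sub>c\<^sub>o: "\<And>t. x\<^sub>c\<^sub>o t \<in> carrier_vec (2 * n\<^sub>1)"
    and x\<^sub>c\<^sub>c: "\<And>t. x\<^sub>c\<^sub>c t \<in> carrier_vec (2 * n\<^sub>2)"
    and x: "\<And>t. x t = q\<^sub>h t @\<^sub>v p\<^sub>h t @\<^sub>v x\<^sub>c\<^sub>o t @\<^sub>v x\<^sub>c\<^sub>c t"
    and x_selfadjoint: "\<And>t i. i < 2 * n \<Longrightarrow> adj (x t $ i) = x t $ i"
    and x_ccr: "\<And>t. commutator_mat (x t) (x t) =
        map_mat of_cplx (\<i> \<cdot>\<^sub>m diag_block_mat [J_symp n\<^sub>3, J_symp n\<^sub>1, J_symp n\<^sub>2])"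
    \<comment> \<open>Hamiltonian and coupling operators\<close>
    and H\<^sub>h12: "H\<^sub>h12 \<in> carrier_mat n\<^sub>3 n\<^sub>3"
    and H\<^sub>h22: "H\<^sub>h22 \<in> carrier_mat n\<^sub>3 n\<^sub>3"
    and H\<^sub>12: "H\<^sub>12 \<in> carrier_mat n\<^sub>3 (2 * n\<^sub>1)"
    and H\<^sub>13: "H\<^sub>13 \<in> carrier_mat n\<^sub>3 (2 * n\<^sub>2)"
    and H\<^sub>c\<^sub>o: "H\<^sub>c\<^sub>o \<in> carrier_mat (2 * n\<^sub>1) (2 * n\<^sub>1)"
    and H\<^sub>c\<^sub>c: "H\<^sub>c\<^sub>c \<in> carrier_mat (2 * n\<^sub>2) (2 * n\<^sub>2)"
    and H: "H =
         (0\<^sub>m n\<^sub>3 n\<^sub>3       @\<^sub>c H\<^sub>h12  @\<^sub>c 0\<^sub>m n\<^sub>3 (2 * n\<^sub>1)       @\<^sub>c 0\<^sub>m n\<^sub>3 (2 * n\<^sub>2))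
      @\<^sub>r (H\<^sub>h12\<^sup>T          @\<^sub>c H\<^sub>h22  @\<^sub>c H\<^sub>12                  @\<^sub>c H\<^sub>13)
      @\<^sub>r (0\<^sub>m (2 * n\<^sub>1) n\<^sub>3 @\<^sub>c H\<^sub>12\<^sup>T @\<^sub>c H\<^sub>c\<^sub>o                  @\<^sub>c 0\<^sub>m (2 * n\<^sub>1) (2 * n\<^sub>2))
      @\<^sub>r (0\<^sub>m (2 * n\<^sub>2) n\<^sub>3 @\<^sub>c H\<^sub>13\<^sup>T @\<^sub>c 0\<^sub>m (2 * n\<^sub>2) (2 * n\<^sub>1) @\<^sub>c H\<^sub>c\<^sub>c)"
    and H_symmetric: "H\<^sup>T = H"
    and \<Gamma>_dim: "\<Gamma> \<in> carrier_mat m (2 * n)"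
    and \<Gamma>\<^sub>h: "\<Gamma>\<^sub>h \<in> carrier_mat (2 * m) n\<^sub>3"
    and \<Gamma>\<^sub>c\<^sub>o: "\<Gamma>\<^sub>c\<^sub>o \<in> carrier_mat (2 * m) (2 * n\<^sub>1)"
    and \<Gamma>: "breve_mat \<Gamma> = 0\<^sub>m (2 * m) n\<^sub>3 @\<^sub>c \<Gamma>\<^sub>h @\<^sub>c \<Gamma>\<^sub>c\<^sub>o @\<^sub>c 0\<^sub>m (2 * m) (2 * n\<^sub>2)"
    and Hop: "\<And>t. Hop t = scaleC (1 / 2) (x t \<bullet> (map_mat complex_of_real H *\<^sub>o x t))"
    and L: "\<And>t. L t = \<Gamma> *\<^sub>o x t"
    \<comment> \<open>input and output fields and their quadratures\<close>
    and b_dim: "\<And>t. b t \<in> carrier_vec m"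
    and b_commutes: "\<And>t i j. i < m \<Longrightarrow> j < 2 * n \<Longrightarrow> commutator (b t $ i) (x t $ j) = 0"
    and b\<^sub>o\<^sub>u\<^sub>t_dim: "\<And>t. b\<^sub>o\<^sub>u\<^sub>t t \<in> carrier_vec m"
    and b\<^sub>o\<^sub>u\<^sub>t: "\<And>t. breve_vec (b\<^sub>o\<^sub>u\<^sub>t t) = breve_vec (L t) + breve_vec (b t)"
    and u: "\<And>t. u t = V_quad m *\<^sub>o breve_vec (b t)"
    and y: "\<And>t. y t = V_quad m *\<^sub>o breve_vec (b\<^sub>o\<^sub>u\<^sub>t t)"
  shows
    "let
       R = map_mat complex_of_real;
       A\<^sub>h11 = (R H\<^sub>h12)\<^sup>T;
       A\<^sub>h12 = R H\<^sub>h22 - (\<i> / 2) \<cdot>\<^sub>m (dagger \<Gamma>\<^sub>h * J_sig m * \<Gamma>\<^sub>h);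
       A\<^sub>h22 = - R H\<^sub>h12;
       A\<^sub>12 = R H\<^sub>12 - (\<i> / 2) \<cdot>\<^sub>m (dagger \<Gamma>\<^sub>h * J_sig m * \<Gamma>\<^sub>c\<^sub>o);
       A\<^sub>13 = R H\<^sub>13;
       A\<^sub>c\<^sub>o = J_symp n\<^sub>1 * R H\<^sub>c\<^sub>o - (\<i> / 2) \<cdot>\<^sub>m (J_symp n\<^sub>1 * dagger \<Gamma>\<^sub>c\<^sub>o * J_sig m * \<Gamma>\<^sub>c\<^sub>o);
       A\<^sub>c\<^sub>c = J_symp n\<^sub>2 * R H\<^sub>c\<^sub>c;
       A\<^sub>21 = J_symp n\<^sub>1 * (R H\<^sub>12)\<^sup>T - (\<i> / 2) \<cdot>\<^sub>m (J_symp n\<^sub>1 * dagger \<Gamma>\<^sub>c\<^sub>o * J_sig m * \<Gamma>\<^sub>h);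
       A\<^sub>31 = J_symp n\<^sub>2 * (R H\<^sub>13)\<^sup>T;
       B\<^sub>h = dagger \<Gamma>\<^sub>h * dagger (V_quad m) * J_symp m;
       B\<^sub>c\<^sub>o = J_symp n\<^sub>1 * dagger \<Gamma>\<^sub>c\<^sub>o * dagger (V_quad m) * J_symp m;
       C\<^sub>h = V_quad m * \<Gamma>\<^sub>h;
       C\<^sub>c\<^sub>o = V_quad m * \<Gamma>\<^sub>c\<^sub>o;
       A =
            (A\<^sub>h11             @\<^sub>c A\<^sub>h12 @\<^sub>c A\<^sub>12                  @\<^sub>c A\<^sub>13)
         @\<^sub>r (0\<^sub>m n\<^sub>3 n\<^sub>3       @\<^sub>c A\<^sub>h22 @\<^sub>c 0\<^sub>m n\<^sub>3 (2 * n\<^sub>1)       @\<^sub>c 0\<^sub>m n\<^sub>3 (2 * n\<^sub>2))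
         @\<^sub>r (0\<^sub>m (2 * n\<^sub>1) n\<^sub>3 @\<^sub>c A\<^sub>21  @\<^sub>c A\<^sub>c\<^sub>o                  @\<^sub>c 0\<^sub>m (2 * n\<^sub>1) (2 * n\<^sub>2))
         @\<^sub>r (0\<^sub>m (2 * n\<^sub>2) n\<^sub>3 @\<^sub>c A\<^sub>31  @\<^sub>c 0\<^sub>m (2 * n\<^sub>2) (2 * n\<^sub>1) @\<^sub>c A\<^sub>c\<^sub>c);
       B = B\<^sub>h @\<^sub>r 0\<^sub>m n\<^sub>3 (2 * m) @\<^sub>r B\<^sub>c\<^sub>o @\<^sub>r 0\<^sub>m (2 * n\<^sub>2) (2 * m);
       C = 0\<^sub>m (2 * m) n\<^sub>3 @\<^sub>c C\<^sub>h @\<^sub>c C\<^sub>c\<^sub>o @\<^sub>c 0\<^sub>m (2 * m) (2 * n\<^sub>2)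
     in ((\<forall>i < 2 * n. satisfies_qsde ddt Hop L b (\<lambda>t. x t $ i))
           \<longleftrightarrow> (\<forall>t. ddt_vec ddt x t = A *\<^sub>o x t + B *\<^sub>o u t))
        \<and> (\<forall>t. y t = C *\<^sub>o x t + u t)"
proof -
  define R where "R = (map_mat complex_of_real :: real mat \<Rightarrow> complex mat)"
  define J where "J = diag_block_mat [J_symp n\<^sub>3, J_symp n\<^sub>1, J_symp n\<^sub>2]"
  define \<Lambda> where "\<Lambda> = breve_mat \<Gamma>"
  have dims[simp]:
    "dim_row H\<^sub>h12 = n\<^sub>3" "dim_col H\<^sub>h12 = n\<^sub>3" "dim_row H\<^sub>h22 = n\<^sub>3" "dim_col H\<^sub>h22 = n\<^sub>3"
    "dim_row H\<^sub>12 = n\<^sub>3" "dim_col H\<^sub>12 = 2 * n\<^sub>1" "dim_row H\<^sub>13 = n\<^sub>3" "dim_col H\<^sub>13 = 2 * n\<^sub>2"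
    "dim_row H\<^sub>c\<^sub>o = 2 * n\<^sub>1" "dim_col H\<^sub>c\<^sub>o = 2 * n\<^sub>1" "dim_row H\<^sub>c\<^sub>c = 2 * n\<^sub>2" "dim_col H\<^sub>c\<^sub>c = 2 * n\<^sub>2"
    "dim_row \<Gamma>\<^sub>h = 2 * m" "dim_col \<Gamma>\<^sub>h = n\<^sub>3" "dim_row \<Gamma>\<^sub>c\<^sub>o = 2 * m" "dim_col \<Gamma>\<^sub>c\<^sub>o = 2 * n\<^sub>1"
    "dim_row \<Gamma> = m" "dim_col \<Gamma> = 2 * n"
    using H\<^sub>h12 H\<^sub>h22 H\<^sub>12 H\<^sub>13 H\<^sub>c\<^sub>o H\<^sub>c\<^sub>c \<Gamma>\<^sub>h \<Gamma>\<^sub>c\<^sub>o \<Gamma>_dim by auto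
  have dims_R[simp]: "dim_row (R M) = dim_row M" "dim_col (R M) = dim_col M" for M
    by (simp_all add: R_def)
  have R_T: "R (M\<^sup>T) = (R M)\<^sup>T" for M
    unfolding R_def by (intro eq_matI) auto
  have R_0: "R (0\<^sub>m k l) = 0\<^sub>m k l" for k l
    unfolding R_def by (intro eq_matI) auto
  have x_dim: "x t \<in> carrier_vec (2 * n)" for t
    using q\<^sub>h[of t] p\<^sub>h[of t] x\<^sub>c\<^sub>o[of t] x\<^sub>c\<^sub>c[of t] unfolding x n by (intro carrier_vecI) simp
  have J_dim: "J \<in> carrier_mat (2 * n) (2 * n)"
    unfolding J_def n by (intro carrier_matI) (simp_all add: dim_diag_block_mat)
  have J_skew: "J\<^sup>T = - J"
    unfolding J_def by (rule diag_block_mat_skew) (auto simp: J_symp_skew)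
  have ccr: "commutator (x t $ j) (x t $ k) = of_cplx (\<i> * J $$ (j, k))"
    if "j < 2 * n" "k < 2 * n" for t j k
    using arg_cong[OF x_ccr[of t, folded J_def], of "\<lambda>M. M $$ (j, k)"] that x_dim[of t] J_dim
    by (simp add: commutator_mat_def)
  have H_dim: "H \<in> carrier_mat (2 * n) (2 * n)"
    unfolding H n by (intro carrier_matI) simp_all
  then have RH: "R H \<in> carrier_mat (2 * n) (2 * n)" "(R H)\<^sup>T = R H"
    using H_symmetric by (simp_all add: R_def flip: R_T[unfolded R_def])
  note R_append = map_append_rows[of _ _ complex_of_real, folded R_def]
    map_append_cols[of _ _ complex_of_real, folded R_def]
  \<comment> \<open>The three system matrices are introduced without partition, as the equation of
    motion delivers them; the facts \<open>A\<close>, \<open>B\<close> and \<open>C\<close> below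
    identify them with the block matrices of the claim.\<close>
  define A where "A = J * R H - (\<i> / 2) \<cdot>\<^sub>m (J * dagger \<Lambda> * J_sig m * \<Lambda>)"
  define B where "B = J * dagger \<Lambda> * (dagger (V_quad m) * J_symp m)"
  define C where "C = V_quad m * \<Lambda>"
  have A: "A =
         ((R H\<^sub>h12)\<^sup>T @\<^sub>c (R H\<^sub>h22 - (\<i> / 2) \<cdot>\<^sub>m (dagger \<Gamma>\<^sub>h * J_sig m * \<Gamma>\<^sub>h))
          @\<^sub>c (R H\<^sub>12 - (\<i> / 2) \<cdot>\<^sub>m (dagger \<Gamma>\<^sub>h * J_sig m * \<Gamma>\<^sub>c\<^sub>o)) @\<^sub>c R H\<^sub>13)
      @\<^sub>r (0\<^sub>m n\<^sub>3 n\<^sub>3 @\<^sub>c - R H\<^sub>h12 @\<^sub>c 0\<^sub>m n\<^sub>3 (2 * n\<^sub>1) @\<^sub>c 0\<^sub>m n\<^sub>3 (2 * n\<^sub>2))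
      @\<^sub>r (0\<^sub>m (2 * n\<^sub>1) n\<^sub>3
          @\<^sub>c (J_symp n\<^sub>1 * (R H\<^sub>12)\<^sup>T - (\<i> / 2) \<cdot>\<^sub>m (J_symp n\<^sub>1 * dagger \<Gamma>\<^sub>c\<^sub>o * J_sig m * \<Gamma>\<^sub>h))
          @\<^sub>c (J_symp n\<^sub>1 * R H\<^sub>c\<^sub>o - (\<i> / 2) \<cdot>\<^sub>m (J_symp n\<^sub>1 * dagger \<Gamma>\<^sub>c\<^sub>o * J_sig m * \<Gamma>\<^sub>c\<^sub>o))
          @\<^sub>c 0\<^sub>m (2 * n\<^sub>1) (2 * n\<^sub>2))
      @\<^sub>r (0\<^sub>m (2 * n\<^sub>2) n\<^sub>3 @\<^sub>c J_symp n\<^sub>2 * (R H\<^sub>13)\<^sup>T @\<^sub>c 0\<^sub>m (2 * n\<^sub>2) (2 * n\<^sub>1) @\<^sub>c J_symp n\<^sub>2 * R H\<^sub>c\<^sub>c)"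
    unfolding A_def \<Lambda>_def \<Gamma> H J_def
    by (simp add: R_append R_T R_0 drift_blocks del: assoc_mult_mat diag_block_mat.simps)
  have B: "B = (dagger \<Gamma>\<^sub>h * dagger (V_quad m) * J_symp m) @\<^sub>r 0\<^sub>m n\<^sub>3 (2 * m)
      @\<^sub>r (J_symp n\<^sub>1 * dagger \<Gamma>\<^sub>c\<^sub>o * dagger (V_quad m) * J_symp m) @\<^sub>r 0\<^sub>m (2 * n\<^sub>2) (2 * m)"
    unfolding B_def \<Lambda>_def \<Gamma> J_def
    \<comment> \<open>Reassociation reconciles the factor
      \<open>dagger (V_quad m) * J_symp m\<close> with the left-nested products of the
      claim.\<close>
    by (simp add: input_blocks mult_mat_assoc del: assoc_mult_mat diag_block_mat.simps)
  have C: "C = 0\<^sub>m (2 * m) n\<^sub>3 @\<^sub>c V_quad m * \<Gamma>\<^sub>h @\<^sub>c V_quad m * \<Gamma>\<^sub>c\<^sub>o @\<^sub>c 0\<^sub>m (2 * m) (2 * n\<^sub>2)"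
    unfolding C_def \<Lambda>_def \<Gamma> by (simp add: block_simps del: assoc_mult_mat)
  have rhs: "qsde_rhs (Hop t) (L t) (b t) (x t $ i) = (A *\<^sub>o x t + B *\<^sub>o u t) $ i"
    if "i < 2 * n" for t i
    unfolding Hop L u A_def B_def \<Lambda>_def R_def[symmetric]
    by (rule qsde_rhs_canonical[OF x_dim J_dim J_skew ccr x_selfadjoint RH \<Gamma>_dim b_dim that])
  \<comment> \<open>A sum of vectors has the dimension of its second summand, so the rows of
    \<open>B\<close> determine the length of the right-hand side.\<close>
  have dim_B: "dim_row B = 2 * n"
    unfolding B_def using J_dim by simp
  have "ddt_vec ddt x t = A *\<^sub>o x t + B *\<^sub>o u t
      \<longleftrightarrow> (\<forall>i < 2 * n. ddt (\<lambda>s. x s $ i) t = qsde_rhs (Hop t) (L t) (b t) (x t $ i))" for t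
    \<comment> \<open>Entries of the vector sum are not split, since \<open>rhs\<close> speaks about
      the sum as a whole.\<close>
    using x_dim[of t] by (simp add: vec_eq_iff dim_B ddt_vec_def rhs del: index_add_vec(1))
  then have dynamics: "(\<forall>i < 2 * n. satisfies_qsde ddt Hop L b (\<lambda>t. x t $ i))
      \<longleftrightarrow> (\<forall>t. ddt_vec ddt x t = A *\<^sub>o x t + B *\<^sub>o u t)"
    by (auto simp: satisfies_qsde_def)
  \<comment> \<open>The output equation is linear in the doubled-up fields, so it only requires
    moving \<open>V_quad m\<close> through the sum and regrouping.\<close>
  have outputs: "y t = C *\<^sub>o x t + u t" for t
  proof -
    have dim: "dim_vec (x t) = 2 * n" "dim_vec (b t) = m"
      using x_dim[of t] b_dim[of t] by auto
    have "breve_vec (L t) = \<Lambda> *\<^sub>o x t"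
      unfolding L \<Lambda>_def using x_selfadjoint by (intro breve_vec_cmat_mult_vec) (simp_all add: dim)
    then have "y t = V_quad m *\<^sub>o (\<Lambda> *\<^sub>o x t) + V_quad m *\<^sub>o breve_vec (b t)"
      unfolding y b\<^sub>o\<^sub>u\<^sub>t by (simp add: cmat_mult_vec_add_right dim \<Lambda>_def)
    also have "V_quad m *\<^sub>o (\<Lambda> *\<^sub>o x t) = C *\<^sub>o x t"
      unfolding C_def by (rule cmat_mult_vec_assoc[symmetric]) (simp_all add: \<Lambda>_def dim)
    finally show ?thesis
      unfolding u .
  qed
  show ?thesis
    unfolding Let_def R_def[symmetric] A[symmetric] B[symmetric] C[symmetric]
    using dynamics outputs by blast
qed

end
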